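(* Let $n=1$, let $E$ be a smooth manifold of dimension $1+m$ ($m\ge1$) and let $\Gamma,\Gamma'$ be torsion-free linear connections on $TE\to E$. Then, in local coordinates, the system of equations $$\Gamma_\lambda{}^k{}_\xi=\Gamma'_\lambda{}^k{}_\xi,$$ $$\delta^\beta_\xi(\Gamma_\lambda{}^k{}_i-\Gamma'_\lambda{}^k{}_i)+\delta^\beta_\lambda(\Gamma_i{}^k{}_\xi-\Gamma'_i{}^k{}_\xi)=\delta_i^k(\Gamma_\lambda{}^\beta{}_\xi-\Gamma'_\lambda{}^\beta{}_\xi),$$ $$2\delta^\beta_\lambda\delta^\alpha_\xi(\Gamma_j{}^k{}_i-\Gamma'_j{}^k{}_i)=\delta^\alpha_\xi\delta^k_j(\Gamma_\lambda{}^\beta{}_i-\Gamma'_\lambda{}^\beta{}_i)+\delta^k_j\delta^\alpha_\lambda(\Gamma_i{}^\beta{}_\xi-\Gamma'_i{}^\beta{}_\xi)+\delta^\alpha_\xi\delta^k_i(\Gamma_\lambda{}^\beta{}_j-\Gamma'_\lambda{}^\beta{}_j)+\delta^k_i\delta^\alpha_\lambda(\Gamma_j{}^\beta{}_\xi-\Gamma'_j{}^\beta{}_\xi),$$ $$\Gamma_j{}^\beta{}_i=\Gamma'_j{}^\beta{}_i$$ (for all values of the free indices) reduces to the condition $$\Gamma_A{}^C{}_B-\Gamma'_A{}^C{}_B=\delta^C_A\Phi_B+\delta^C_B\Phi_A$$ for some local smooth functions $\Phi_A$ on $E$, i.e. the system holds if and only if such functions $\Phi_A$ exist.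
   Context: $(u^\lambda,u^i)$ are local coordinates on $E$ where, in general, Greek indices run in $1..n$ (here $n=1$, so all Greek indices equal $1$), lower-case Latin indices run in $n+1..n+m$ and capital indices in $1..n+m$. $\Gamma_A{}^C{}_B$ and $\Gamma'_A{}^C{}_B$ are the Christoffel symbols ($\nabla_{\partial_A}\partial_B=\Gamma_A{}^C{}_B\partial_C$), symmetric in $A,B$. The last displayed condition is the classical local condition of projective equivalence. *)

theory Defs
  imports "HOL-Analysis.Analysis"
begin

section \<open>Smooth maps between open subsets of normed spaces\<close>

text \<open>For open \<open>S\<close>, \<open>C_on k S f\<close> says that \<open>f\<close> is of class \<open>C\<^sup>k\<close> on \<open>S\<close> in the case of a
  finite-dimensional domain: all directional derivatives up to order \<open>k\<close> exist on \<open>S\<close> and are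
  continuous there.\<close>

primrec C_on :: "nat \<Rightarrow> 'a::real_normed_vector set \<Rightarrow> ('a \<Rightarrow> 'b::real_normed_vector) \<Rightarrow> bool" where
  "C_on 0 S f \<longleftrightarrow> continuous_on S f"
| "C_on (Suc k) S f \<longleftrightarrow> (\<forall>x\<in>S. f differentiable (at x)) \<and>
     (\<forall>v. C_on k S (\<lambda>x. frechet_derivative f (at x) v))"

definition smooth_on :: "'a::real_normed_vector set \<Rightarrow> ('a \<Rightarrow> 'b::real_normed_vector) \<Rightarrow> bool" where
  "smooth_on S f \<longleftrightarrow> (\<forall>k. C_on k S f)"


section \<open>Smooth manifolds\<close>

text \<open>A chart is a pair of its domain and its coordinate map; the values of the latter outside the
  domain are irrelevant. The dimension of the manifold is \<open>CARD('i)\<close>.\<close>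

type_synonym ('p, 'i) chart = "'p set \<times> ('p \<Rightarrow> real ^ 'i)"

definition is_chart :: "'p topology \<Rightarrow> ('p, 'i::finite) chart \<Rightarrow> bool" where
  "is_chart E c \<longleftrightarrow> (case c of (U, u) \<Rightarrow>
     openin E U \<and> open (u ` U) \<and>
     homeomorphic_map (subtopology E U) (top_of_set (u ` U)) u)"

definition compatible :: "('p, 'i::finite) chart \<Rightarrow> ('p, 'i) chart \<Rightarrow> bool" where
  "compatible c d \<longleftrightarrow> (case c of (U, u) \<Rightarrow> case d of (V, v) \<Rightarrow>
     smooth_on (u ` (U \<inter> V)) (v \<circ> inv_into U u) \<and>
     smooth_on (v ` (U \<inter> V)) (u \<circ> inv_into V v))"

text \<open>The atlas is required to be maximal, so that its members are exactly the local coordinate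
  systems of the manifold.\<close>

definition smooth_manifold :: "'p topology \<Rightarrow> ('p, 'i::finite) chart set \<Rightarrow> bool" where
  "smooth_manifold E \<A> \<longleftrightarrow>
     Hausdorff_space E \<and> second_countable E \<and>
     (\<forall>c\<in>\<A>. is_chart E c) \<and>
     (\<Union>c\<in>\<A>. fst c) = topspace E \<and>
     (\<forall>c\<in>\<A>. \<forall>d\<in>\<A>. compatible c d) \<and>
     (\<forall>c. is_chart E c \<and> (\<forall>d\<in>\<A>. compatible c d) \<longrightarrow> c \<in> \<A>)"


section \<open>Smooth functions and vector fields on an open subset\<close>

text \<open>A real function on \<open>U\<close> is represented by its extension by zero, so that equality of functions
  on \<open>U\<close> is equality in HOL and the pointwise operations stay within \<open>smooth_funs \<A> U\<close>.\<close>

definition smooth_funs :: "('p, 'i::finite) chart set \<Rightarrow> 'p set \<Rightarrow> ('p \<Rightarrow> real) set" where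
  "smooth_funs \<A> U = {f. (\<forall>p. p \<notin> U \<longrightarrow> f p = 0) \<and>
     (\<forall>(V, v)\<in>\<A>. smooth_on (v ` (U \<inter> V)) (f \<circ> inv_into V v))}"

definition restr :: "'p set \<Rightarrow> ('p \<Rightarrow> real) \<Rightarrow> 'p \<Rightarrow> real" where
  "restr V f = (\<lambda>p. if p \<in> V then f p else 0)"

text \<open>Smooth vector fields on \<open>U\<close> are the derivations of the algebra of smooth functions on \<open>U\<close>
  (extended by zero to all other arguments).\<close>

type_synonym 'p vfield = "('p \<Rightarrow> real) \<Rightarrow> 'p \<Rightarrow> real"

definition vector_fields :: "('p, 'i::finite) chart set \<Rightarrow> 'p set \<Rightarrow> 'p vfield set" where
  "vector_fields \<A> U = {X.
     (\<forall>f. f \<notin> smooth_funs \<A> U \<longrightarrow> X f = (\<lambda>p. 0)) \<and>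
     (\<forall>f\<in>smooth_funs \<A> U. X f \<in> smooth_funs \<A> U) \<and>
     (\<forall>f\<in>smooth_funs \<A> U. \<forall>g\<in>smooth_funs \<A> U.
        X (\<lambda>p. f p + g p) = (\<lambda>p. X f p + X g p)) \<and>
     (\<forall>f\<in>smooth_funs \<A> U. \<forall>c. X (\<lambda>p. c * f p) = (\<lambda>p. c * X f p)) \<and>
     (\<forall>f\<in>smooth_funs \<A> U. \<forall>g\<in>smooth_funs \<A> U.
        X (\<lambda>p. f p * g p) = (\<lambda>p. X f p * g p + f p * X g p))}"

definition vf_add :: "'p vfield \<Rightarrow> 'p vfield \<Rightarrow> 'p vfield" where
  "vf_add X Y = (\<lambda>f p. X f p + Y f p)"

definition vf_diff :: "'p vfield \<Rightarrow> 'p vfield \<Rightarrow> 'p vfield" where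
  "vf_diff X Y = (\<lambda>f p. X f p - Y f p)"

definition vf_scale :: "('p \<Rightarrow> real) \<Rightarrow> 'p vfield \<Rightarrow> 'p vfield" where
  "vf_scale h X = (\<lambda>f p. h p * X f p)"

definition lie_bracket :: "'p vfield \<Rightarrow> 'p vfield \<Rightarrow> 'p vfield" where
  "lie_bracket X Y = (\<lambda>f p. X (Y f) p - Y (X f) p)"

text \<open>For open \<open>V \<subseteq> U\<close> and a vector field \<open>X\<close> on \<open>U\<close>, this determines the vector field \<open>X'\<close> on \<open>V\<close>
  uniquely, because every smooth function on \<open>V\<close> agrees near any given point of \<open>V\<close> with the
  restriction of a smooth function on \<open>U\<close>.\<close>

definition vf_restricts ::
  "('p, 'i::finite) chart set \<Rightarrow> 'p set \<Rightarrow> 'p set \<Rightarrow> 'p vfield \<Rightarrow> 'p vfield \<Rightarrow> bool" where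
  "vf_restricts \<A> U V X X' \<longleftrightarrow> (\<forall>f\<in>smooth_funs \<A> U. X' (restr V f) = restr V (X f))"

definition coord_field ::
  "('p, 'i::finite) chart set \<Rightarrow> ('p, 'i) chart \<Rightarrow> 'i \<Rightarrow> 'p vfield" where
  "coord_field \<A> c I = (case c of (U, u) \<Rightarrow> \<lambda>f p.
     if f \<in> smooth_funs \<A> U \<and> p \<in> U
     then frechet_derivative (f \<circ> inv_into U u) (at (u p)) (axis I 1) else 0)"


section \<open>Linear connections\<close>

text \<open>A linear connection is given by its covariant derivatives \<open>\<nabla> U X Y\<close> on all open sets \<open>U\<close>,
  which are compatible with restriction.\<close>

type_synonym 'p connection = "'p set \<Rightarrow> 'p vfield \<Rightarrow> 'p vfield \<Rightarrow> 'p vfield"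

definition linear_connection ::
  "'p topology \<Rightarrow> ('p, 'i::finite) chart set \<Rightarrow> 'p connection \<Rightarrow> bool" where
  "linear_connection E \<A> nabla \<longleftrightarrow>
     (\<forall>U. openin E U \<longrightarrow>
        (\<forall>X\<in>vector_fields \<A> U. \<forall>Y\<in>vector_fields \<A> U.
           nabla U X Y \<in> vector_fields \<A> U \<and>
           (\<forall>Z\<in>vector_fields \<A> U.
              nabla U (vf_add X Z) Y = vf_add (nabla U X Y) (nabla U Z Y) \<and>
              nabla U X (vf_add Y Z) = vf_add (nabla U X Y) (nabla U X Z)) \<and>
           (\<forall>h\<in>smooth_funs \<A> U.
              nabla U (vf_scale h X) Y = vf_scale h (nabla U X Y) \<and>
              nabla U X (vf_scale h Y) = vf_add (vf_scale (X h) Y) (vf_scale h (nabla U X Y))))) \<and>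
     (\<forall>U V. openin E U \<and> openin E V \<and> V \<subseteq> U \<longrightarrow>
        (\<forall>X\<in>vector_fields \<A> U. \<forall>Y\<in>vector_fields \<A> U.
         \<forall>X'\<in>vector_fields \<A> V. \<forall>Y'\<in>vector_fields \<A> V.
           vf_restricts \<A> U V X X' \<and> vf_restricts \<A> U V Y Y' \<longrightarrow>
           vf_restricts \<A> U V (nabla U X Y) (nabla V X' Y')))"

definition torsion_free ::
  "'p topology \<Rightarrow> ('p, 'i::finite) chart set \<Rightarrow> 'p connection \<Rightarrow> bool" where
  "torsion_free E \<A> nabla \<longleftrightarrow>
     (\<forall>U. openin E U \<longrightarrow> (\<forall>X\<in>vector_fields \<A> U. \<forall>Y\<in>vector_fields \<A> U.
        vf_diff (nabla U X Y) (nabla U Y X) = lie_bracket X Y))"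

text \<open>\<open>\<Gamma> A C B p\<close> stands for \<open>\<Gamma>\<^sub>A\<^sup>C\<^sub>B(p)\<close>, where
  \<open>\<nabla>\<^bsub>\<partial>\<^sub>A\<^esub> \<partial>\<^sub>B = \<Gamma>\<^sub>A\<^sup>C\<^sub>B \<partial>\<^sub>C\<close> on the domain of the chart.\<close>

definition christoffel_symbols ::
  "('p, 'i::finite) chart set \<Rightarrow> 'p connection \<Rightarrow> ('p, 'i) chart \<Rightarrow>
   ('i \<Rightarrow> 'i \<Rightarrow> 'i \<Rightarrow> 'p \<Rightarrow> real) \<Rightarrow> bool" where
  "christoffel_symbols \<A> nabla c \<Gamma> \<longleftrightarrow>
     (\<forall>A B. \<forall>f\<in>smooth_funs \<A> (fst c). \<forall>p\<in>fst c.
        nabla (fst c) (coord_field \<A> c A) (coord_field \<A> c B) f p =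
        (\<Sum>C\<in>UNIV. \<Gamma> A C B p * coord_field \<A> c C f p))"

definition kron :: "'i \<Rightarrow> 'i \<Rightarrow> real" where
  "kron a b = (if a = b then 1 else 0)"

end

theory Submission
  imports Defs
begin

text \<open>Write \<open>D\<^sub>A\<^sup>C\<^sub>B = \<Gamma>\<^sub>A\<^sup>C\<^sub>B - \<Gamma>'\<^sub>A\<^sup>C\<^sub>B\<close> and let \<open>o\<close> be the only Greek index. Once \<open>D\<close> is known to be
  symmetric in its lower indices and smooth, the statement is linear algebra at each point: the
  system says \<open>D\<^sub>o\<^sup>k\<^sub>o = 0\<close>, \<open>D\<^sub>j\<^sup>o\<^sub>i = 0\<close>, \<open>2 D\<^sub>o\<^sup>k\<^sub>i = \<delta>\<^sup>k\<^sub>i D\<^sub>o\<^sup>o\<^sub>o\<close> and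
  \<open>D\<^sub>j\<^sup>k\<^sub>i = \<delta>\<^sup>k\<^sub>j D\<^sub>o\<^sup>o\<^sub>i + \<delta>\<^sup>k\<^sub>i D\<^sub>o\<^sup>o\<^sub>j\<close>, which is the condition of projective equivalence with
  \<open>\<Phi>\<^sub>o = D\<^sub>o\<^sup>o\<^sub>o / 2\<close> and \<open>\<Phi>\<^sub>i = D\<^sub>o\<^sup>o\<^sub>i\<close> (lemmas \<open>projective_difference_solves_system\<close> and
  \<open>system_imp_projective_difference\<close>).

  Symmetry and smoothness come from evaluating the connection on coordinate functions: since
  \<open>\<partial>\<^sub>A u\<^sup>C = \<delta>\<^sup>C\<^sub>A\<close>, one has \<open>\<Gamma>\<^sub>A\<^sup>C\<^sub>B = (\<nabla>\<^bsub>\<partial>\<^sub>A\<^esub> \<partial>\<^sub>B) u\<^sup>C\<close>. This is smooth because a vector field maps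
  smooth functions to smooth functions, and symmetric because the torsion vanishes and
  \<open>[\<partial>\<^sub>A, \<partial>\<^sub>B] u\<^sup>C = 0\<close>. The one analytic point is that \<open>\<partial>\<^sub>A\<close> is a smooth vector field in the
  derivation sense (lemma \<open>coord_field_in_vector_fields\<close>): that the partial derivative of a smooth
  function is smooth when read in \<^emph>\<open>any other\<close> chart needs the closure of smooth maps under
  composition.\<close>

section \<open>Calculus of smooth maps\<close>

lemma frechet_derivative_cong_open:
  assumes "open S" "x \<in> S" "\<And>y. y \<in> S \<Longrightarrow> f y = g y"
  shows "frechet_derivative f (at x) = frechet_derivative g (at x)"
proof -
  have "(f has_derivative D) (at x) \<longleftrightarrow> (g has_derivative D) (at x)" for D
    using has_derivative_transform_within_open[of f D x UNIV S g]
      has_derivative_transform_within_open[of g D x UNIV S f] assms by auto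
  then show ?thesis
    by (simp add: frechet_derivative_def)
qed

lemma differentiable_cong_open:
  assumes "open S" "x \<in> S" "\<And>y. y \<in> S \<Longrightarrow> f y = g y" "f differentiable (at x)"
  shows "g differentiable (at x)"
  using assms has_derivative_transform_within_open[of f _ x UNIV S g]
  unfolding differentiable_def by blast

lemma C_on_cong:
  assumes "open S" "C_on k S f" "\<And>x. x \<in> S \<Longrightarrow> f x = g x"
  shows "C_on k S g"
  using assms(2,3)
proof (induction k arbitrary: f g)
  case 0
  then show ?case
    using continuous_on_cong[of S S f g] by simp
next
  case (Suc k)
  have "g differentiable (at x)" if "x \<in> S" for x
    using differentiable_cong_open[of S x f g] assms(1) that Suc.prems by simp
  moreover have "C_on k S (\<lambda>x. frechet_derivative g (at x) v)" for v
  proof (rule Suc.IH)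
    show "C_on k S (\<lambda>x. frechet_derivative f (at x) v)"
      using Suc.prems by simp
    show "frechet_derivative f (at x) v = frechet_derivative g (at x) v" if "x \<in> S" for x
      using frechet_derivative_cong_open[of S x f g] assms(1) that Suc.prems by simp
  qed
  ultimately show ?case by simp
qed

lemma C_on_SucI:
  assumes "open S" "\<And>x. x \<in> S \<Longrightarrow> (f has_derivative f' x) (at x)"
    and "\<And>v. C_on k S (\<lambda>x. f' x v)"
  shows "C_on (Suc k) S f"
proof -
  have "C_on k S (\<lambda>x. frechet_derivative f (at x) v)" for v
    by (rule C_on_cong[OF assms(1) assms(3)[of v]]) (simp flip: frechet_derivative_at[OF assms(2)])
  then show ?thesis
    using assms(2) by (auto simp: differentiable_def)
qed

lemma C_on_SucD:
  assumes "C_on (Suc k) S f"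
  shows "\<And>x. x \<in> S \<Longrightarrow> (f has_derivative frechet_derivative f (at x)) (at x)"
    and "C_on k S (\<lambda>x. frechet_derivative f (at x) v)"
  using assms by (auto simp: frechet_derivative_works)

lemma C_on_Suc_imp_C_on: "C_on (Suc k) S f \<Longrightarrow> C_on k S f"
proof (induction k arbitrary: f)
  case 0
  then show ?case
    by (auto intro!: differentiable_imp_continuous_on
        simp: differentiable_on_def differentiable_at_withinI)
next
  case (Suc k)
  show ?case
    using C_on_SucD(1)[OF Suc.prems] Suc.IH[OF C_on_SucD(2)[OF Suc.prems]]
    by (auto simp: differentiable_def)
qed

lemma C_on_const: "open S \<Longrightarrow> C_on k S (\<lambda>x. c)"
proof (induction k arbitrary: c)
  case 0
  then show ?case by simp
next
  case (Suc k)
  then show ?case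
    by (intro C_on_SucI[where f' = "\<lambda>x v. 0"]) auto
qed

lemma C_on_add:
  assumes "open S" "C_on k S f" "C_on k S g"
  shows "C_on k S (\<lambda>x. f x + g x)"
  using assms(2,3)
proof (induction k arbitrary: f g)
  case 0
  then show ?case by (simp add: continuous_on_add)
next
  case (Suc k)
  show ?case
  proof (rule C_on_SucI[OF assms(1)])
    show "((\<lambda>x. f x + g x) has_derivative
        (\<lambda>v. frechet_derivative f (at x) v + frechet_derivative g (at x) v)) (at x)"
      if "x \<in> S" for x
      by (intro has_derivative_add Suc.prems[THEN C_on_SucD(1)] that)
    show "C_on k S (\<lambda>x. frechet_derivative f (at x) v + frechet_derivative g (at x) v)" for v
      by (intro Suc.IH C_on_SucD(2) Suc.prems)
  qed
qed

lemma C_on_sum: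
  assumes "open S" "finite I" "\<And>i. i \<in> I \<Longrightarrow> C_on k S (f i)"
  shows "C_on k S (\<lambda>x. \<Sum>i\<in>I. f i x)"
  using assms(2,3)
  by (induction I rule: finite_induct) (auto simp: C_on_const C_on_add assms(1))

lemma C_on_bounded_linear:
  assumes "open S" "bounded_linear L" "C_on k S f"
  shows "C_on k S (\<lambda>x. L (f x))"
  using assms(3)
proof (induction k arbitrary: f)
  case 0
  then show ?case
    by (simp add: bounded_linear.continuous_on[OF assms(2)])
next
  case (Suc k)
  show ?case
  proof (rule C_on_SucI[OF assms(1)])
    show "((\<lambda>x. L (f x)) has_derivative (\<lambda>v. L (frechet_derivative f (at x) v))) (at x)"
      if "x \<in> S" for x
      by (rule bounded_linear.has_derivative[OF assms(2) C_on_SucD(1)[OF Suc.prems that]])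
    show "C_on k S (\<lambda>x. L (frechet_derivative f (at x) v))" for v
      by (rule Suc.IH[OF C_on_SucD(2)[OF Suc.prems]])
  qed
qed

lemma C_on_mult:
  fixes f g :: "'a::real_normed_vector \<Rightarrow> real"
  assumes "open S" "C_on k S f" "C_on k S g"
  shows "C_on k S (\<lambda>x. f x * g x)"
  using assms(2,3)
proof (induction k arbitrary: f g)
  case 0
  then show ?case by (simp add: continuous_on_mult)
next
  case (Suc k)
  show ?case
  proof (rule C_on_SucI[OF assms(1)])
    show "((\<lambda>x. f x * g x) has_derivative
        (\<lambda>v. f x * frechet_derivative g (at x) v + frechet_derivative f (at x) v * g x)) (at x)"
      if "x \<in> S" for x
      by (intro has_derivative_mult Suc.prems[THEN C_on_SucD(1)] that)
    show "C_on k S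
        (\<lambda>x. f x * frechet_derivative g (at x) v + frechet_derivative f (at x) v * g x)" for v
      by (intro C_on_add assms(1) Suc.IH Suc.prems[THEN C_on_SucD(2)]
          Suc.prems[THEN C_on_Suc_imp_C_on])
  qed
qed

text \<open>Induction on the order, for all maps at once: by the chain rule, each directional derivative
  of the composition is a sum of products of the partial derivatives of the outer map, composed
  with the inner one, and components of a directional derivative of the inner map, all of which
  have one order of differentiability less.\<close>

lemma C_on_compose:
  fixes f :: "'a::real_normed_vector \<Rightarrow> 'b::euclidean_space" and h :: "'b \<Rightarrow> real"
  assumes "open S" "open T" "f ` S \<subseteq> T" "C_on k T h" "C_on k S f"
  shows "C_on k S (\<lambda>x. h (f x))"
  using assms(4,5)
proof (induction k arbitrary: h)
  case 0
  then show ?case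
    using continuous_on_compose2[of T h S f] assms(3) by simp
next
  case (Suc k)
  let ?Df = "\<lambda>x. frechet_derivative f (at x)" and ?Dh = "\<lambda>y. frechet_derivative h (at y)"
  show ?case
  proof (rule C_on_SucI[OF assms(1), where f' = "\<lambda>x v. ?Dh (f x) (?Df x v)"])
    fix x assume x: "x \<in> S"
    then have "f x \<in> T"
      using assms(3) by blast
    then show "((\<lambda>x. h (f x)) has_derivative (\<lambda>v. ?Dh (f x) (?Df x v))) (at x)"
      by (rule has_derivative_compose[OF C_on_SucD(1)[OF Suc.prems(2) x] C_on_SucD(1)[OF Suc.prems(1)]])
  next
    fix v
    have "C_on k S (\<lambda>x. \<Sum>b\<in>Basis. ?Dh (f x) b * (?Df x v \<bullet> b))"
      by (intro C_on_sum C_on_mult C_on_bounded_linear[OF _ bounded_linear_inner_left] Suc.IH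
          Suc.prems[THEN C_on_SucD(2)] C_on_Suc_imp_C_on[OF Suc.prems(2)] assms(1) finite_Basis)
    moreover have "(\<Sum>b\<in>Basis. ?Dh (f x) b * (?Df x v \<bullet> b)) = ?Dh (f x) (?Df x v)"
      if "x \<in> S" for x
    proof -
      have "linear (?Dh (f x))"
        using C_on_SucD(1)[OF Suc.prems(1)] that assms(3) has_derivative_linear by blast
      then have "?Dh (f x) (\<Sum>b\<in>Basis. (?Df x v \<bullet> b) *\<^sub>R b)
          = (\<Sum>b\<in>Basis. (?Df x v \<bullet> b) *\<^sub>R ?Dh (f x) b)"
        by (simp add: linear_sum linear_cmul)
      then show ?thesis
        by (simp add: euclidean_representation mult.commute)
    qed
    ultimately show "C_on k S (\<lambda>x. ?Dh (f x) (?Df x v))"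
      by (rule C_on_cong[OF assms(1)])
  qed
qed

lemma smooth_on_cong:
  assumes "open S" "smooth_on S f" "\<And>x. x \<in> S \<Longrightarrow> f x = g x"
  shows "smooth_on S g"
  using assms C_on_cong unfolding smooth_on_def by blast

lemma smooth_on_derivative: "smooth_on S f \<Longrightarrow> smooth_on S (\<lambda>x. frechet_derivative f (at x) v)"
  unfolding smooth_on_def using C_on_SucD(2) by blast

lemma smooth_on_imp_differentiable: "smooth_on S f \<Longrightarrow> x \<in> S \<Longrightarrow> f differentiable (at x)"
  unfolding smooth_on_def by (metis C_on.simps(2))

lemma smooth_on_compose:
  fixes f :: "'a::real_normed_vector \<Rightarrow> 'b::euclidean_space" and h :: "'b \<Rightarrow> real"
  assumes "open S" "open T" "f ` S \<subseteq> T" "smooth_on T h" "smooth_on S f"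
  shows "smooth_on S (\<lambda>x. h (f x))"
  using assms C_on_compose unfolding smooth_on_def by blast

section \<open>Charts and smooth functions\<close>

context
  fixes E :: "'p topology" and \<A> :: "('p, 'i::finite) chart set"
  assumes M: "smooth_manifold E \<A>"
begin

lemma chart_openin: "(U, u) \<in> \<A> \<Longrightarrow> openin E U"
  using M by (fastforce simp: smooth_manifold_def is_chart_def)

lemma chart_inj_on:
  assumes "(U, u) \<in> \<A>" shows "inj_on u U"
proof -
  have "homeomorphic_map (subtopology E U) (top_of_set (u ` U)) u" "openin E U"
    using M assms by (fastforce simp: smooth_manifold_def is_chart_def)+
  then show ?thesis
    using homeomorphic_imp_injective_map openin_subset topspace_subtopology_subset by metis
qed

lemma chart_image_open:
  assumes "(U, u) \<in> \<A>" "openin E W" shows "open (u ` (W \<inter> U))"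
proof -
  have h: "homeomorphic_map (subtopology E U) (top_of_set (u ` U)) u" "open (u ` U)"
    using M assms by (fastforce simp: smooth_manifold_def is_chart_def)+
  have "openin (subtopology E U) (W \<inter> U)"
    using assms(2) by (auto simp: openin_subtopology)
  then have "openin (top_of_set (u ` U)) (u ` (W \<inter> U))"
    using homeomorphic_imp_open_map[OF h(1)] by (auto simp: open_map_def)
  then show ?thesis
    using h(2) openin_open_trans by blast
qed

lemma transition_smooth:
  assumes "(U, u) \<in> \<A>" "(V, v) \<in> \<A>"
  shows "smooth_on (v ` (U \<inter> V)) (u \<circ> inv_into V v)"
  using M assms by (fastforce simp: smooth_manifold_def compatible_def)

lemma smooth_funs_chart:
  assumes "(U, u) \<in> \<A>" "f \<in> smooth_funs \<A> U"
  shows "smooth_on (u ` U) (f \<circ> inv_into U u)"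
  using assms by (fastforce simp: smooth_funs_def)

lemma smooth_funs_differentiable:
  assumes "(U, u) \<in> \<A>" "f \<in> smooth_funs \<A> U" "p \<in> U"
  shows "((f \<circ> inv_into U u) has_derivative frechet_derivative (f \<circ> inv_into U u) (at (u p)))
    (at (u p))"
  using smooth_on_imp_differentiable[OF smooth_funs_chart[OF assms(1,2)]] assms(3)
  by (simp add: frechet_derivative_works)

text \<open>A single argument for sums, products and multiples. The condition \<open>F 0 0 = 0\<close> keeps the result
  an extension by zero.\<close>

lemma smooth_funs_pointwise:
  assumes "openin E U" "f \<in> smooth_funs \<A> U" "g \<in> smooth_funs \<A> U"
    and "F 0 0 = (0::real)"
    and "\<And>k S (f::real^'i \<Rightarrow> real) g. open S \<Longrightarrow> C_on k S f \<Longrightarrow> C_on k S g \<Longrightarrow>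
      C_on k S (\<lambda>x. F (f x) (g x))"
  shows "(\<lambda>p. F (f p) (g p)) \<in> smooth_funs \<A> U"
proof -
  have "smooth_on (v ` (U \<inter> V)) ((\<lambda>p. F (f p) (g p)) \<circ> inv_into V v)" if "(V, v) \<in> \<A>" for V v
    using assms(2,3) that assms(5)[OF chart_image_open[OF that assms(1)]]
    by (fastforce simp: smooth_funs_def smooth_on_def o_def)
  then show ?thesis
    using assms by (auto simp: smooth_funs_def)
qed

lemma smooth_funs_add:
  assumes "openin E U" "f \<in> smooth_funs \<A> U" "g \<in> smooth_funs \<A> U"
  shows "(\<lambda>p. f p + g p) \<in> smooth_funs \<A> U"
  by (rule smooth_funs_pointwise[OF assms, of "(+)"]) (auto intro: C_on_add)

lemma smooth_funs_mult:
  assumes "openin E U" "f \<in> smooth_funs \<A> U" "g \<in> smooth_funs \<A> U"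
  shows "(\<lambda>p. f p * g p) \<in> smooth_funs \<A> U"
  by (rule smooth_funs_pointwise[OF assms, of "(*)"]) (auto intro: C_on_mult)

lemma smooth_funs_cmult:
  assumes "openin E U" "f \<in> smooth_funs \<A> U"
  shows "(\<lambda>p. c * f p) \<in> smooth_funs \<A> U"
  by (rule smooth_funs_pointwise[OF assms assms(2), of "\<lambda>a b. c * a"])
    (auto intro: C_on_mult C_on_const)

lemma smooth_funs_diff:
  assumes "openin E U" "f \<in> smooth_funs \<A> U" "g \<in> smooth_funs \<A> U"
  shows "(\<lambda>p. f p - g p) \<in> smooth_funs \<A> U"
  using smooth_funs_add[OF assms(1,2) smooth_funs_cmult[OF assms(1,3), of "-1"]] by simp

section \<open>Coordinate functions and coordinate fields\<close>

lemma coordinate_function_smooth: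
  assumes "(U, u) \<in> \<A>"
  shows "restr U (\<lambda>p. u p $ C) \<in> smooth_funs \<A> U"
proof -
  have "smooth_on (v ` (U \<inter> V)) (restr U (\<lambda>p. u p $ C) \<circ> inv_into V v)"
    if V: "(V, v) \<in> \<A>" for V v
  proof (rule smooth_on_cong)
    show o: "open (v ` (U \<inter> V))"
      by (rule chart_image_open[OF V chart_openin[OF assms]])
    show "smooth_on (v ` (U \<inter> V)) (\<lambda>x. (u \<circ> inv_into V v) x $ C)"
      using transition_smooth[OF assms V] C_on_bounded_linear[OF o bounded_linear_vec_nth]
      unfolding smooth_on_def by blast
    show "(u \<circ> inv_into V v) x $ C = (restr U (\<lambda>p. u p $ C) \<circ> inv_into V v) x"
      if "x \<in> v ` (U \<inter> V)" for x
      using that chart_inj_on[OF V] by (auto simp: restr_def)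
  qed
  then show ?thesis
    by (auto simp: smooth_funs_def restr_def)
qed

lemma coord_field_coordinate_function:
  assumes "(U, u) \<in> \<A>" "p \<in> U"
  shows "coord_field \<A> (U, u) A (restr U (\<lambda>p. u p $ C)) p = kron C A"
proof -
  have o: "open (u ` U)"
    using chart_image_open[OF assms(1) chart_openin[OF assms(1)]] by simp
  have "(restr U (\<lambda>p. u p $ C) \<circ> inv_into U u) y = y $ C" if "y \<in> u ` U" for y
    using that chart_inj_on[OF assms(1)] by (auto simp: restr_def)
  then have "frechet_derivative (restr U (\<lambda>p. u p $ C) \<circ> inv_into U u) (at (u p))
      = frechet_derivative (\<lambda>y. y $ C) (at (u p))"
    using assms(2) by (intro frechet_derivative_cong_open[OF o]) auto
  also have "\<dots> = (\<lambda>y. y $ C)"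
    using frechet_derivative_at[OF bounded_linear_imp_has_derivative[OF bounded_linear_vec_nth]]
    by metis
  finally show ?thesis
    using assms coordinate_function_smooth[OF assms(1)]
    by (simp add: coord_field_def axis_def kron_def)
qed

text \<open>Read in the chart \<open>(U, u)\<close>, the function \<open>\<partial>\<^sub>A f\<close> is a partial derivative, hence smooth; in
  another chart it is this smooth function after a smooth change of coordinates.\<close>

lemma coord_field_smooth:
  assumes "(U, u) \<in> \<A>" "f \<in> smooth_funs \<A> U"
  shows "coord_field \<A> (U, u) A f \<in> smooth_funs \<A> U"
proof -
  let ?D = "\<lambda>y. frechet_derivative (f \<circ> inv_into U u) (at y) (axis A 1)"
  have o: "open (u ` U)"
    using chart_image_open[OF assms(1) chart_openin[OF assms(1)]] by simp
  have "smooth_on (v ` (U \<inter> V)) (coord_field \<A> (U, u) A f \<circ> inv_into V v)"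
    if V: "(V, v) \<in> \<A>" for V v
  proof (rule smooth_on_cong)
    show oV: "open (v ` (U \<inter> V))"
      by (rule chart_image_open[OF V chart_openin[OF assms(1)]])
    show "smooth_on (v ` (U \<inter> V)) (\<lambda>x. ?D ((u \<circ> inv_into V v) x))"
    proof (rule smooth_on_compose[OF oV o])
      show "(u \<circ> inv_into V v) ` (v ` (U \<inter> V)) \<subseteq> u ` U"
        using chart_inj_on[OF V] by auto
      show "smooth_on (u ` U) ?D"
        by (rule smooth_on_derivative[OF smooth_funs_chart[OF assms]])
    qed (rule transition_smooth[OF assms(1) V])
    show "?D ((u \<circ> inv_into V v) x) = (coord_field \<A> (U, u) A f \<circ> inv_into V v) x"
      if "x \<in> v ` (U \<inter> V)" for x
      using that chart_inj_on[OF V] assms(2) by (auto simp: coord_field_def)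
  qed
  then show ?thesis
    by (auto simp: smooth_funs_def coord_field_def)
qed

lemma coord_field_in_vector_fields:
  assumes "(U, u) \<in> \<A>"
  shows "coord_field \<A> (U, u) A \<in> vector_fields \<A> U"
proof -
  let ?X = "coord_field \<A> (U, u) A"
  note oU = chart_openin[OF assms]
  have X_eq: "?X h p = D (axis A 1)"
    if "h \<in> smooth_funs \<A> U" "p \<in> U" "((h \<circ> inv_into U u) has_derivative D) (at (u p))" for h p D
    using that frechet_derivative_at[OF that(3)] by (simp add: coord_field_def)
  have X_out: "?X h p = 0" if "p \<notin> U" for h p
    using that by (simp add: coord_field_def)
  have inv_u: "inv_into U u (u p) = p" if "p \<in> U" for p
    using that chart_inj_on[OF assms] by simp
  have add: "?X (\<lambda>p. f p + g p) p = ?X f p + ?X g p"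
    if f: "f \<in> smooth_funs \<A> U" and g: "g \<in> smooth_funs \<A> U" for f g p
  proof (cases "p \<in> U")
    case p: True
    note df = smooth_funs_differentiable[OF assms f p] and dg = smooth_funs_differentiable[OF assms g p]
    have "(((\<lambda>p. f p + g p) \<circ> inv_into U u) has_derivative
        (\<lambda>w. frechet_derivative (f \<circ> inv_into U u) (at (u p)) w
          + frechet_derivative (g \<circ> inv_into U u) (at (u p)) w)) (at (u p))"
      using has_derivative_add[OF df dg] by (simp add: o_def)
    from X_eq[OF smooth_funs_add[OF oU f g] p this] X_eq[OF f p df] X_eq[OF g p dg]
    show ?thesis by simp
  qed (simp add: X_out)
  have cmult: "?X (\<lambda>p. c * f p) p = c * ?X f p"
    if f: "f \<in> smooth_funs \<A> U" for f c p
  proof (cases "p \<in> U")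
    case p: True
    note df = smooth_funs_differentiable[OF assms f p]
    have "(((\<lambda>p. c * f p) \<circ> inv_into U u) has_derivative
        (\<lambda>w. c * frechet_derivative (f \<circ> inv_into U u) (at (u p)) w)) (at (u p))"
      using has_derivative_mult_right[OF df, of c] by (simp add: o_def)
    from X_eq[OF smooth_funs_cmult[OF oU f] p this] X_eq[OF f p df] show ?thesis by simp
  qed (simp add: X_out)
  have mult: "?X (\<lambda>p. f p * g p) p = ?X f p * g p + f p * ?X g p"
    if f: "f \<in> smooth_funs \<A> U" and g: "g \<in> smooth_funs \<A> U" for f g p
  proof (cases "p \<in> U")
    case p: True
    note df = smooth_funs_differentiable[OF assms f p] and dg = smooth_funs_differentiable[OF assms g p]
    have "(((\<lambda>p. f p * g p) \<circ> inv_into U u) has_derivative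
        (\<lambda>w. f p * frechet_derivative (g \<circ> inv_into U u) (at (u p)) w
          + frechet_derivative (f \<circ> inv_into U u) (at (u p)) w * g p)) (at (u p))"
      using has_derivative_mult[OF df dg] by (simp add: o_def inv_u[OF p])
    from X_eq[OF smooth_funs_mult[OF oU f g] p this] X_eq[OF f p df] X_eq[OF g p dg]
    show ?thesis by simp
  qed (simp add: X_out)
  have "?X f = (\<lambda>p. 0)" if "f \<notin> smooth_funs \<A> U" for f
    using that by (simp add: coord_field_def)
  then show ?thesis
    using add cmult mult coord_field_smooth[OF assms] by (simp add: vector_fields_def fun_eq_iff)
qed

section \<open>Christoffel symbols\<close>

text \<open>Evaluating \<open>\<nabla>\<^bsub>\<partial>\<^sub>A\<^esub> \<partial>\<^sub>B = \<Gamma>\<^sub>A\<^sup>C\<^sub>B \<partial>\<^sub>C\<close> on the coordinate functions isolates the coefficients.\<close>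

lemma christoffel_eq:
  assumes "(U, u) \<in> \<A>" "christoffel_symbols \<A> nabla (U, u) \<Gamma>" "p \<in> U"
  shows "\<Gamma> A C B p = nabla U (coord_field \<A> (U, u) A) (coord_field \<A> (U, u) B)
    (restr U (\<lambda>p. u p $ C)) p"
proof -
  have "nabla U (coord_field \<A> (U, u) A) (coord_field \<A> (U, u) B) (restr U (\<lambda>p. u p $ C)) p
      = (\<Sum>C'\<in>UNIV. \<Gamma> A C' B p * coord_field \<A> (U, u) C' (restr U (\<lambda>p. u p $ C)) p)"
    using assms(2,3) coordinate_function_smooth[OF assms(1)] by (simp add: christoffel_symbols_def)
  also have "\<dots> = (\<Sum>C'\<in>UNIV. \<Gamma> A C' B p * kron C C')"
    by (simp add: coord_field_coordinate_function[OF assms(1,3)])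
  also have "\<dots> = \<Gamma> A C B p"
    by (simp add: kron_def if_distrib cong: if_cong)
  finally show ?thesis by simp
qed

lemma christoffel_smooth:
  assumes "(U, u) \<in> \<A>" "christoffel_symbols \<A> nabla (U, u) \<Gamma>" "linear_connection E \<A> nabla"
  shows "restr U (\<Gamma> A C B) \<in> smooth_funs \<A> U"
proof -
  let ?X = "coord_field \<A> (U, u)" and ?x = "restr U (\<lambda>p. u p $ C)"
  have "nabla U (?X A) (?X B) \<in> vector_fields \<A> U"
    using assms(3) chart_openin[OF assms(1)] coord_field_in_vector_fields[OF assms(1)]
    by (simp add: linear_connection_def)
  then have s: "nabla U (?X A) (?X B) ?x \<in> smooth_funs \<A> U"
    using coordinate_function_smooth[OF assms(1)] by (simp add: vector_fields_def)
  then have "restr U (\<Gamma> A C B) = nabla U (?X A) (?X B) ?x"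
    using christoffel_eq[OF assms(1,2)] by (auto simp: restr_def smooth_funs_def fun_eq_iff)
  with s show ?thesis by simp
qed

text \<open>The bracket \<open>[\<partial>\<^sub>A, \<partial>\<^sub>B]\<close> kills each coordinate function, because the first derivatives of the
  latter are constant on the chart; constancy off the chart fails for the extension by zero, but
  only the values on the open image of the chart enter a derivative.\<close>

lemma christoffel_symmetric:
  assumes "(U, u) \<in> \<A>" "christoffel_symbols \<A> nabla (U, u) \<Gamma>" "torsion_free E \<A> nabla" "p \<in> U"
  shows "\<Gamma> A C B p = \<Gamma> B C A p"
proof -
  let ?X = "coord_field \<A> (U, u)" and ?x = "restr U (\<lambda>p. u p $ C)"
  have o: "open (u ` U)"
    using chart_image_open[OF assms(1) chart_openin[OF assms(1)]] by simp
  have second: "?X A (?X B ?x) p = 0" for A B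
  proof -
    have "(?X B ?x \<circ> inv_into U u) y = kron C B" if "y \<in> u ` U" for y
      using that chart_inj_on[OF assms(1)] coord_field_coordinate_function[OF assms(1)] by auto
    then have "frechet_derivative (?X B ?x \<circ> inv_into U u) (at (u p))
        = frechet_derivative (\<lambda>y. kron C B) (at (u p))"
      using assms(4) by (intro frechet_derivative_cong_open[OF o]) auto
    then show ?thesis
      by (simp add: coord_field_def)
  qed
  have "vf_diff (nabla U (?X A) (?X B)) (nabla U (?X B) (?X A)) = lie_bracket (?X A) (?X B)"
    using assms(3) chart_openin[OF assms(1)] coord_field_in_vector_fields[OF assms(1)]
    by (simp add: torsion_free_def)
  from fun_cong[OF fun_cong[OF this, of ?x], of p] show ?thesis
    by (simp add: vf_diff_def lie_bracket_def second christoffel_eq[OF assms(1,2,4)])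
qed

end

section \<open>The pointwise linear algebra\<close>

text \<open>In the two following lemmas \<open>D A C B\<close> stands for \<open>D\<^sub>A\<^sup>C\<^sub>B\<close> at a fixed point. That all Greek indices
  coincide makes every Kronecker delta between them equal to one.\<close>

lemma projective_difference_solves_system:
  fixes D :: "'n + 'm \<Rightarrow> 'n + 'm \<Rightarrow> 'n + 'm \<Rightarrow> real" and \<mu> :: 'n
  assumes one: "\<And>a b::'n. a = b"
    and D: "\<And>A B C. D A C B = kron C A * \<phi> B + kron C B * \<phi> A"
  shows "D (Inl \<mu>) (Inr k) (Inl \<xi>) = 0"
    and "kron \<beta> \<xi> * D (Inl \<mu>) (Inr k) (Inr i) + kron \<beta> \<mu> * D (Inr i) (Inr k) (Inl \<xi>)
      = kron i k * D (Inl \<mu>) (Inl \<beta>) (Inl \<xi>)"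
    and "2 * kron \<beta> \<mu> * kron \<alpha> \<xi> * D (Inr j) (Inr k) (Inr i)
      = kron \<alpha> \<xi> * kron k j * D (Inl \<mu>) (Inl \<beta>) (Inr i)
      + kron k j * kron \<alpha> \<mu> * D (Inr i) (Inl \<beta>) (Inl \<xi>)
      + kron \<alpha> \<xi> * kron k i * D (Inl \<mu>) (Inl \<beta>) (Inr j)
      + kron k i * kron \<alpha> \<mu> * D (Inr j) (Inl \<beta>) (Inl \<xi>)"
    and "D (Inr j) (Inl \<beta>) (Inr i) = 0"
  using one[of \<alpha> \<mu>] one[of \<beta> \<mu>] one[of \<xi> \<mu>] by (auto simp: D kron_def)

text \<open>The formulas for \<open>\<phi>\<close> are forced, being the cases \<open>A = B = C = o\<close> and \<open>A = C = o\<close>, \<open>B = i\<close> of the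
  conclusion. Symmetry merges the two terms on the left of \<open>e2\<close> and pairs the four on the right of
  \<open>e3\<close>, so that the equations determine all components of \<open>D\<close> by \<open>\<phi>\<close>.\<close>

lemma system_imp_projective_difference:
  fixes D :: "'n + 'm \<Rightarrow> 'n + 'm \<Rightarrow> 'n + 'm \<Rightarrow> real" and a :: 'n
  assumes one: "\<And>b::'n. b = a"
    and sym: "\<And>A B C. D A C B = D B C A"
    and e1: "\<And>k. D (Inl a) (Inr k) (Inl a) = 0"
    and e2: "\<And>i k. D (Inl a) (Inr k) (Inr i) + D (Inr i) (Inr k) (Inl a)
      = kron i k * D (Inl a) (Inl a) (Inl a)"
    and e3: "\<And>i j k. 2 * D (Inr j) (Inr k) (Inr i)
      = kron k j * D (Inl a) (Inl a) (Inr i) + kron k j * D (Inr i) (Inl a) (Inl a)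
      + kron k i * D (Inl a) (Inl a) (Inr j) + kron k i * D (Inr j) (Inl a) (Inl a)"
    and e4: "\<And>i j. D (Inr j) (Inl a) (Inr i) = 0"
    and \<phi>: "\<And>b. \<phi> (Inl b) = D (Inl a) (Inl a) (Inl a) / 2" "\<And>i. \<phi> (Inr i) = D (Inl a) (Inl a) (Inr i)"
  shows "D A C B = kron C A * \<phi> B + kron C B * \<phi> A"
proof -
  have mixed: "D (Inl a) (Inr k) (Inr i) = kron i k * D (Inl a) (Inl a) (Inl a) / 2" for i k
    using e2[of k i] sym[of "Inl a" "Inr k" "Inr i"] by simp
  have latin: "D (Inr j) (Inr k) (Inr i)
      = kron k j * D (Inl a) (Inl a) (Inr i) + kron k i * D (Inl a) (Inl a) (Inr j)" for i j k
    using e3[of j k i] sym[of "Inl a" "Inl a" "Inr i"] sym[of "Inl a" "Inl a" "Inr j"] by simp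
  have symLR: "D (Inr i) C (Inl a) = D (Inl a) C (Inr i)" for i C
    by (rule sym)
  have split: "X = Inl a \<or> (\<exists>i. X = Inr i)" for X :: "'n + 'm"
    by (metis one sum.exhaust)
  show ?thesis
    using split[of A] split[of B] split[of C]
    by (elim disjE exE) (simp_all add: symLR e1 e4 latin mixed \<phi> kron_def)
qed

section \<open>Projective equivalence\<close>

theorem proposition4:
  fixes E :: "'p topology"
    and \<A> :: "('p, 'n::finite + 'm::finite) chart set"
    and U :: "'p set" and u :: "'p \<Rightarrow> real ^ ('n + 'm)"
    and nabla nabla' :: "'p connection"
    and \<Gamma> \<Gamma>' :: "'n + 'm \<Rightarrow> 'n + 'm \<Rightarrow> 'n + 'm \<Rightarrow> 'p \<Rightarrow> real"
  assumes "CARD('n) = 1"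
    and "smooth_manifold E \<A>"
    and "linear_connection E \<A> nabla" and "torsion_free E \<A> nabla"
    and "linear_connection E \<A> nabla'" and "torsion_free E \<A> nabla'"
    and "(U, u) \<in> \<A>"
    and "christoffel_symbols \<A> nabla (U, u) \<Gamma>"
    and "christoffel_symbols \<A> nabla' (U, u) \<Gamma>'"
  shows "(\<forall>p\<in>U. \<forall>(\<alpha>::'n) (\<beta>::'n) (\<mu>::'n) (\<xi>::'n) (i::'m) (j::'m) (k::'m).
      \<Gamma> (Inl \<mu>) (Inr k) (Inl \<xi>) p = \<Gamma>' (Inl \<mu>) (Inr k) (Inl \<xi>) p
    \<and>
      kron \<beta> \<xi> * (\<Gamma> (Inl \<mu>) (Inr k) (Inr i) p - \<Gamma>' (Inl \<mu>) (Inr k) (Inr i) p)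
      + kron \<beta> \<mu> * (\<Gamma> (Inr i) (Inr k) (Inl \<xi>) p - \<Gamma>' (Inr i) (Inr k) (Inl \<xi>) p)
      = kron i k * (\<Gamma> (Inl \<mu>) (Inl \<beta>) (Inl \<xi>) p - \<Gamma>' (Inl \<mu>) (Inl \<beta>) (Inl \<xi>) p)
    \<and>
      2 * kron \<beta> \<mu> * kron \<alpha> \<xi> * (\<Gamma> (Inr j) (Inr k) (Inr i) p - \<Gamma>' (Inr j) (Inr k) (Inr i) p)
      = kron \<alpha> \<xi> * kron k j * (\<Gamma> (Inl \<mu>) (Inl \<beta>) (Inr i) p - \<Gamma>' (Inl \<mu>) (Inl \<beta>) (Inr i) p)
      + kron k j * kron \<alpha> \<mu> * (\<Gamma> (Inr i) (Inl \<beta>) (Inl \<xi>) p - \<Gamma>' (Inr i) (Inl \<beta>) (Inl \<xi>) p)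
      + kron \<alpha> \<xi> * kron k i * (\<Gamma> (Inl \<mu>) (Inl \<beta>) (Inr j) p - \<Gamma>' (Inl \<mu>) (Inl \<beta>) (Inr j) p)
      + kron k i * kron \<alpha> \<mu> * (\<Gamma> (Inr j) (Inl \<beta>) (Inl \<xi>) p - \<Gamma>' (Inr j) (Inl \<beta>) (Inl \<xi>) p)
    \<and>
      \<Gamma> (Inr j) (Inl \<beta>) (Inr i) p = \<Gamma>' (Inr j) (Inl \<beta>) (Inr i) p)
  \<longleftrightarrow>
    (\<exists>\<Phi> :: 'n + 'm \<Rightarrow> 'p \<Rightarrow> real.
      (\<forall>A. \<Phi> A \<in> smooth_funs \<A> U) \<and>
      (\<forall>p\<in>U. \<forall>A B C.
         \<Gamma> A C B p - \<Gamma>' A C B p = kron C A * \<Phi> B p + kron C B * \<Phi> A p))"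
proof -
  let ?D = "\<lambda>p A C B. \<Gamma> A C B p - \<Gamma>' A C B p"
  note oU = chart_openin[OF assms(2,7)]
  obtain a :: 'n where one: "b = a" for b
    using assms(1) by (metis UNIV_I card_1_singletonE singletonD)
  then have one': "b = c" for b c :: 'n
    by metis
  have kron1: "kron b c = 1" for b c :: 'n
    using one'[of b c] by (simp add: kron_def)
  show ?thesis (is "?system \<longleftrightarrow> ?projective")
  proof
    assume sys: ?system
    define \<Phi> where "\<Phi> A = (case A of
        Inl _ \<Rightarrow> (\<lambda>p. 1 / 2 * (restr U (\<Gamma> (Inl a) (Inl a) (Inl a)) p
          - restr U (\<Gamma>' (Inl a) (Inl a) (Inl a)) p))
      | Inr i \<Rightarrow> (\<lambda>p. restr U (\<Gamma> (Inl a) (Inl a) (Inr i)) p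
          - restr U (\<Gamma>' (Inl a) (Inl a) (Inr i)) p))"
      for A :: "'n + 'm"
    note \<Gamma>_smooth = christoffel_smooth[OF assms(2,7,8,3)] christoffel_smooth[OF assms(2,7,9,5)]
    have "\<Phi> A \<in> smooth_funs \<A> U" for A
      unfolding \<Phi>_def
      by (cases A; simp only: sum.case;
          intro smooth_funs_cmult[OF assms(2) oU] smooth_funs_diff[OF assms(2) oU] \<Gamma>_smooth)
    moreover have "?D p A C B = kron C A * \<Phi> B p + kron C B * \<Phi> A p" if p: "p \<in> U" for p A B C
    proof (rule system_imp_projective_difference[where a = a and D = "?D p" and \<phi> = "\<lambda>A. \<Phi> A p"])
      show "?D p A C B = ?D p B C A" for A B C
        using christoffel_symmetric[OF assms(2,7,8,4) p] christoffel_symmetric[OF assms(2,7,9,6) p]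
        by metis
      show "b = a" for b
        by (rule one)
      note eqs = bspec[OF sys p, THEN spec, of a, THEN spec, of a, THEN spec, of a, THEN spec, of a,
          unfolded kron1 mult_1_left mult_1_right]
      show "?D p (Inl a) (Inr k) (Inl a) = 0" for k
        using eqs by simp
      show "?D p (Inl a) (Inr k) (Inr i) + ?D p (Inr i) (Inr k) (Inl a)
          = kron i k * ?D p (Inl a) (Inl a) (Inl a)" for i k
        using eqs by blast
      show "2 * ?D p (Inr j) (Inr k) (Inr i)
          = kron k j * ?D p (Inl a) (Inl a) (Inr i) + kron k j * ?D p (Inr i) (Inl a) (Inl a)
          + kron k i * ?D p (Inl a) (Inl a) (Inr j) + kron k i * ?D p (Inr j) (Inl a) (Inl a)" for i j k
        using eqs by blast
      show "?D p (Inr j) (Inl a) (Inr i) = 0" for i j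
        using eqs by simp
    qed (use p in \<open>simp_all add: \<Phi>_def restr_def\<close>)
    ultimately show ?projective
      by blast
  next
    assume ?projective
    then obtain \<Phi> where \<Phi>: "?D p A C B = kron C A * \<Phi> B p + kron C B * \<Phi> A p"
      if "p \<in> U" for p A B C
      by blast
    show ?system
    proof (intro ballI allI conjI, goal_cases)
      case (1 p \<alpha> \<beta> \<mu> \<xi> i j k)
      show ?case
        using projective_difference_solves_system(1)[where D = "?D p", OF one' \<Phi>[OF 1]] by simp
    next
      case (2 p \<alpha> \<beta> \<mu> \<xi> i j k)
      show ?case
        by (rule projective_difference_solves_system(2)[where D = "?D p", OF one' \<Phi>[OF 2]])
    next
      case (3 p \<alpha> \<beta> \<mu> \<xi> i j k)
      show ?case
        by (rule projective_difference_solves_system(3)[where D = "?D p", OF one' \<Phi>[OF 3]])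
    next
      case (4 p \<alpha> \<beta> \<mu> \<xi> i j k)
      show ?case
        using projective_difference_solves_system(4)[where D = "?D p", OF one' \<Phi>[OF 4]] by simp
    qed
  qed
qed

end
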